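(* Let $(X,\|\cdot\|)$ be a normed linear space over $\mathbb{C}$, let $n\ge 1$ be an integer, $(\alpha_1,\dots,\alpha_n)\in\mathbb{C}^n$, $(p_1,\dots,p_n)\in\mathbb{R}_+^n$ with $\sum_{i=1}^n p_i=1$, and $(x_1,\dots,x_n)\in X^n$. If there exist complex numbers $a,A\in\mathbb{C}$ such that $$\operatorname{Re}\left[(A-\alpha_i)(\overline{\alpha_i}-\overline{a})\right]\ge 0\quad\text{for each } i\in\{1,\dots,n\},$$ or, equivalently, $$\left|\alpha_i-\frac{a+A}{2}\right|\le\frac12|A-a|\quad\text{for each } i\in\{1,\dots,n\},$$ then $$\left\|\sum_{i=1}^n p_i\alpha_i x_i-\sum_{i=1}^n p_i\alpha_i\cdot\sum_{i=1}^n p_i x_i\right\|\le \frac12|A-a|\sum_{i=1}^n p_i\left\|x_i-\sum_{j=1}^n p_j x_j\right\|.$$ Moreover, the constant $\frac12$ is best possible: if $C>0$ is a constant such that the inequality with $\frac12$ replaced by $C$ on the right-hand side holds for all normed linear spaces $X$ over $\mathbb{C}$, all integers $n\ge 1$, all $(\alpha_1,\dots,\alpha_n)\in\mathbb{C}^n$, all $(p_1,\dots,p_n)\in\mathbb{R}_+^n$ with $\sum_{i=1}^n p_i=1$, all $(x_1,\dots,x_n)\in X^n$, and all $a,A\in\mathbb{C}$ with $\left|\alpha_i-\frac{a+A}{2}\right|\le\frac12|A-a|$ for each $i\in\{1,\dots,n\}$, then $C\ge\frac12$.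
   Context: $\mathbb{R}_+$ denotes the set of nonnegative real numbers. *)

theory Defs
  imports "HOL-Analysis.Analysis" "HOL-Algebra.Module" "HOL-Algebra.Algebraic_Closure_Type"
begin

text \<open>
  A normed linear space over the complex field, with an explicit carrier: the library has only the
  type class of real normed spaces, and a statement that quantifies over normed spaces inside a
  formula cannot be phrased with type classes. The ring \<open>ring_of_type_algebra :: complex ring\<close>
  is the field of complex numbers with carrier \<open>UNIV\<close>, and a module over it is a complex
  vector space. As in the class \<open>real_normed_vector\<close>, nonnegativity of the norm follows
  from the axioms. The fields \<open>mult\<close> and \<open>one\<close> of the record \<open>V\<close> are
  inherited from the library's record of modules and play no role.

  Since a formula cannot quantify over types, a hypothesis about all normed spaces has to fix the type
  of the carriers. The hypothesis of the best-constant claim takes carriers in \<open>complex\<close>,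
  which makes it weaker, and hence the claim stronger, than with all normed spaces.
\<close>

locale complex_normed_space =
  module "ring_of_type_algebra :: complex ring" V
  for V :: "(complex, 'a) module" (structure) and N :: "'a \<Rightarrow> real" +
  assumes norm_eq_zero_iff: "x \<in> carrier V \<Longrightarrow> N x = 0 \<longleftrightarrow> x = \<zero>"
    and norm_smult: "x \<in> carrier V \<Longrightarrow> N (c \<odot> x) = cmod c * N x"
    and norm_triangle: "x \<in> carrier V \<Longrightarrow> y \<in> carrier V \<Longrightarrow> N (x \<oplus> y) \<le> N x + N y"

end

theory Submission
  imports Defs
begin

text \<open>
  Put \<open>m = \<Sum> p\<^sub>j x\<^sub>j\<close> and \<open>c = (a + A) / 2\<close>. Since the weights sum to 1, \<open>\<Sum> p\<^sub>i (x\<^sub>i - m) = 0\<close>,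
  so \<open>\<alpha>\<^sub>i\<close> may be shifted by any constant: the Chebyshev difference
  \<open>\<Sum> p\<^sub>i \<alpha>\<^sub>i x\<^sub>i - (\<Sum> p\<^sub>i \<alpha>\<^sub>i) m\<close> equals \<open>\<Sum> p\<^sub>i (\<alpha>\<^sub>i - c) (x\<^sub>i - m)\<close>, and the triangle inequality
  gives the bound. Equality holds in \<open>\<complex>\<close> for \<open>n = 2\<close>, \<open>p = (1/2, 1/2)\<close> and \<open>\<alpha> = x = (0, 1)\<close>.
\<close>

lemma ring_of_type_algebra_sel [simp]:
  "carrier ring_of_type_algebra = UNIV"
  "a \<oplus>\<^bsub>ring_of_type_algebra\<^esub> b = a + b"
  "a \<otimes>\<^bsub>ring_of_type_algebra\<^esub> b = a * b"
  "\<zero>\<^bsub>ring_of_type_algebra\<^esub> = 0"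
  "\<one>\<^bsub>ring_of_type_algebra\<^esub> = 1"
  by (simp_all add: ring_of_type_algebra_def)

text \<open>With \<open>u = (A - a) / 2\<close> and \<open>v = z - (a + A) / 2\<close> the factors
  are \<open>A - z = u - v\<close> and \<open>z - a = u + v\<close>. The cross terms of
  \<open>(u - v) * cnj (u + v)\<close> are purely imaginary, so its real part is the difference of
  the squared moduli of \<open>u\<close> and \<open>v\<close>.\<close>

lemma Re_mult_cnj_diff_nonneg_iff:
  "0 \<le> Re ((A - z) * (cnj z - cnj a)) \<longleftrightarrow> cmod (z - (a + A) / 2) \<le> 1 / 2 * cmod (A - a)"
proof -
  have "Re ((A - z) * (cnj z - cnj a)) = (1 / 2 * cmod (A - a))\<^sup>2 - (cmod (z - (a + A) / 2))\<^sup>2"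
    unfolding power_mult_distrib cmod_power2
    by (simp add: power2_eq_square field_simps)
  then show ?thesis
    using abs_le_square_iff[of "cmod (z - (a + A) / 2)" "1 / 2 * cmod (A - a)"] by simp
qed

context complex_normed_space
begin

text \<open>This and the next four lemmas recast module laws in ordinary complex arithmetic, with
  the membership conditions on scalars discharged.\<close>

lemma smult_closed' [simp]: "x \<in> carrier V \<Longrightarrow> c \<odot> x \<in> carrier V"
  using smult_closed[of c x] by simp

lemma smult_add_left: "x \<in> carrier V \<Longrightarrow> (c + d) \<odot> x = c \<odot> x \<oplus> d \<odot> x"
  using smult_l_distr[of c d x] by simp

lemma smult_zero_left [simp]: "x \<in> carrier V \<Longrightarrow> 0 \<odot> x = \<zero>"
  using smult_l_null[of x] by simp

lemma smult_one_left [simp]: "x \<in> carrier V \<Longrightarrow> 1 \<odot> x = x"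
  using smult_one[of x] by simp

lemma smult_mult_left: "x \<in> carrier V \<Longrightarrow> (c * d) \<odot> x = c \<odot> (d \<odot> x)"
  using smult_assoc1[of c d x] by simp

lemma smult_diff_right:
  "x \<in> carrier V \<Longrightarrow> y \<in> carrier V \<Longrightarrow> c \<odot> (x \<ominus> y) = c \<odot> x \<ominus> c \<odot> y"
  using smult_r_distr[of c x "\<ominus> y"] smult_r_minus[of c y] by (simp add: a_minus_def)

lemma finsum_smult_left:
  assumes "finite I" "m \<in> carrier V"
  shows "(\<Oplus>i\<in>I. w i \<odot> m) = (\<Sum>i\<in>I. w i) \<odot> m"
  using assms by (induction I rule: finite_induct) (simp_all add: smult_add_left)

text \<open>Each \<open>w i \<odot> x i\<close> is split as
  \<open>w i \<odot> (x i \<ominus> m) \<oplus> w i \<odot> m\<close>. The sum of the second parts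
  is a multiple of \<open>m\<close>, which is then moved to the other side.\<close>

lemma finsum_smult_diff:
  assumes "finite I" "\<And>i. i \<in> I \<Longrightarrow> x i \<in> carrier V" "m \<in> carrier V"
  shows "(\<Oplus>i\<in>I. w i \<odot> (x i \<ominus> m)) = (\<Oplus>i\<in>I. w i \<odot> x i) \<ominus> (\<Sum>i\<in>I. w i) \<odot> m"
proof -
  have "(\<Oplus>i\<in>I. w i \<odot> x i) = (\<Oplus>i\<in>I. w i \<odot> (x i \<ominus> m) \<oplus> w i \<odot> m)"
    using assms
    by (intro finsum_cong') (simp_all add: smult_diff_right, simp_all add: a_minus_def a_assoc l_neg)
  also have "\<dots> = (\<Oplus>i\<in>I. w i \<odot> (x i \<ominus> m)) \<oplus> (\<Sum>i\<in>I. w i) \<odot> m"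
    using assms by (subst finsum_addf) (auto simp: finsum_smult_left)
  finally show ?thesis
    using assms by (simp add: a_minus_def a_assoc r_neg)
qed

lemma norm_finsum_le:
  assumes "finite I" "\<And>i. i \<in> I \<Longrightarrow> f i \<in> carrier V"
  shows "N (\<Oplus>i\<in>I. f i) \<le> (\<Sum>i\<in>I. N (f i))"
  using assms
proof (induction I rule: finite_induct)
  case empty
  then show ?case using norm_eq_zero_iff[of \<zero>] by simp
next
  case (insert i I)
  then have "N (f i \<oplus> (\<Oplus>i\<in>I. f i)) \<le> N (f i) + N (\<Oplus>i\<in>I. f i)"
    by (intro norm_triangle) auto
  with insert show ?case by (simp add: Pi_def)
qed

text \<open>The triangle inequality for \<open>x\<close> and its negative bounds
  \<open>N \<zero> = 0\<close> by \<open>2 * N x\<close>.\<close>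

lemma norm_nonneg:
  assumes "x \<in> carrier V"
  shows "0 \<le> N x"
proof -
  have "N (x \<oplus> (-1) \<odot> x) \<le> N x + N ((-1) \<odot> x)"
    using assms by (intro norm_triangle) auto
  moreover have "x \<oplus> (-1) \<odot> x = \<zero>"
    using assms smult_add_left[of x 1 "-1"] by simp
  ultimately show ?thesis
    using assms norm_eq_zero_iff[of \<zero>] by (simp add: norm_smult)
qed

lemma chebyshev_difference_shift:
  assumes "finite I" and x: "\<And>i. i \<in> I \<Longrightarrow> x i \<in> carrier V" and p: "(\<Sum>i\<in>I. p i) = 1"
  defines "m \<equiv> \<Oplus>i\<in>I. p i \<odot> x i"
  shows "(\<Oplus>i\<in>I. (p i * \<alpha> i) \<odot> x i) \<ominus> (\<Sum>i\<in>I. p i * \<alpha> i) \<odot> m =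
    (\<Oplus>i\<in>I. (p i * (\<alpha> i - c)) \<odot> (x i \<ominus> m))"
proof -
  have m: "m \<in> carrier V"
    unfolding m_def using x by (intro finsum_closed) auto
  \<comment> \<open>With weights \<open>p\<close> of total 1, \<open>finsum_smult_diff\<close> gives
    \<open>m \<ominus> 1 \<odot> m\<close>.\<close>
  have "(\<Oplus>i\<in>I. p i \<odot> (x i \<ominus> m)) = \<zero>"
    using finsum_smult_diff[of I x m p] assms(1) x m p by (simp add: r_neg a_minus_def flip: m_def)
  then have "(\<Oplus>i\<in>I. c \<odot> (p i \<odot> (x i \<ominus> m))) = \<zero>"
    using assms(1) x m finsum_smult_ldistr[of I c "\<lambda>i. p i \<odot> (x i \<ominus> m)"] smult_r_null[of c]
    by (simp add: Pi_def)
  \<comment> \<open>Splitting \<open>\<alpha> i\<close> as \<open>(\<alpha> i - c) + c\<close>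
    isolates the sum just shown to vanish.\<close>
  moreover have "(\<Oplus>i\<in>I. (p i * \<alpha> i) \<odot> (x i \<ominus> m)) =
      (\<Oplus>i\<in>I. (p i * (\<alpha> i - c)) \<odot> (x i \<ominus> m) \<oplus> c \<odot> (p i \<odot> (x i \<ominus> m)))"
    using x m
    by (intro finsum_cong') (auto simp: algebra_simps simp flip: smult_add_left smult_mult_left)
  ultimately have "(\<Oplus>i\<in>I. (p i * \<alpha> i) \<odot> (x i \<ominus> m)) =
      (\<Oplus>i\<in>I. (p i * (\<alpha> i - c)) \<odot> (x i \<ominus> m))"
    using x m by (simp add: finsum_addf Pi_def)
  \<comment> \<open>With weights \<open>p i * \<alpha> i\<close>, \<open>finsum_smult_diff\<close>
    identifies the centred sum with the Chebyshev difference.\<close>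
  then show ?thesis
    using finsum_smult_diff[of I x m "\<lambda>i. p i * \<alpha> i"] assms(1) x m by simp
qed

text \<open>The bound is stated for any disc with centre \<open>c\<close> and radius
  \<open>r\<close> containing the \<open>\<alpha> i\<close>; the points \<open>a\<close> and
  \<open>A\<close> enter only when it is applied.\<close>

lemma norm_chebyshev_difference_le:
  fixes p :: "'i \<Rightarrow> real"
  assumes "finite I" and x: "\<And>i. i \<in> I \<Longrightarrow> x i \<in> carrier V"
    and p0: "\<And>i. i \<in> I \<Longrightarrow> 0 \<le> p i" and p1: "(\<Sum>i\<in>I. p i) = 1"
    and r: "\<And>i. i \<in> I \<Longrightarrow> cmod (\<alpha> i - c) \<le> r"
  defines "m \<equiv> \<Oplus>i\<in>I. complex_of_real (p i) \<odot> x i"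
  shows "N ((\<Oplus>i\<in>I. (complex_of_real (p i) * \<alpha> i) \<odot> x i)
      \<ominus> (\<Sum>i\<in>I. complex_of_real (p i) * \<alpha> i) \<odot> m) \<le> r * (\<Sum>i\<in>I. p i * N (x i \<ominus> m))"
    (is "N ?D \<le> _")
proof -
  have m: "m \<in> carrier V"
    unfolding m_def using x by (intro finsum_closed) auto
  have "(\<Sum>i\<in>I. complex_of_real (p i)) = 1"
    using p1 by (simp flip: of_real_sum)
  then have "?D = (\<Oplus>i\<in>I. (complex_of_real (p i) * (\<alpha> i - c)) \<odot> (x i \<ominus> m))"
    unfolding m_def using assms(1) x by (intro chebyshev_difference_shift) auto
  also have "N \<dots> \<le> (\<Sum>i\<in>I. N ((complex_of_real (p i) * (\<alpha> i - c)) \<odot> (x i \<ominus> m)))"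
    using assms(1) x m by (intro norm_finsum_le) auto
  \<comment> \<open>Nonnegativity of the weights lets \<open>p i\<close> come out of the modulus
    unchanged.\<close>
  also have "\<dots> = (\<Sum>i\<in>I. cmod (\<alpha> i - c) * (p i * N (x i \<ominus> m)))"
    using x m p0 by (intro sum.cong) (auto simp: norm_smult norm_mult)
  also have "\<dots> \<le> (\<Sum>i\<in>I. r * (p i * N (x i \<ominus> m)))"
    using x m p0 r by (intro sum_mono mult_right_mono) (auto intro!: norm_nonneg mult_nonneg_nonneg)
  finally show ?thesis
    by (simp add: sum_distrib_left)
qed

end

text \<open>The complex numbers as a normed space over themselves: the space in which the constant
  is attained.\<close>

definition complex_line :: "(complex, complex) module" where
  "complex_line = \<lparr>carrier = UNIV, monoid.mult = (*), one = 1, ring.zero = 0, add = (+), smult = (*)\<rparr>"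

lemma complex_line_sel [simp]:
  "carrier complex_line = UNIV"
  "a \<oplus>\<^bsub>complex_line\<^esub> b = a + b"
  "\<zero>\<^bsub>complex_line\<^esub> = 0"
  "a \<odot>\<^bsub>complex_line\<^esub> b = a * b"
  by (simp_all add: complex_line_def)

lemma complex_normed_space_complex_line: "complex_normed_space complex_line cmod"
proof -
  have "abelian_group complex_line"
    by (rule abelian_groupI) (auto simp: algebra_simps intro: exI[of _ "- x" for x])
  then have "module ring_of_type_algebra complex_line"
    by (intro moduleI cring_from_type_algebra) (auto simp: algebra_simps)
  then show ?thesis
    by (intro complex_normed_space.intro complex_normed_space_axioms.intro)
      (auto simp: norm_mult norm_triangle_ineq)
qed

interpretation complex_line: complex_normed_space complex_line cmod
  by (rule complex_normed_space_complex_line)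

lemma minus_complex_line [simp]: "a \<ominus>\<^bsub>complex_line\<^esub> b = a - b"
proof -
  \<comment> \<open>The inverse is not a field of the record, so it is identified by uniqueness of
    additive inverses.\<close>
  have "\<ominus>\<^bsub>complex_line\<^esub> b = - b"
    by (rule complex_line.minus_equality) auto
  then show ?thesis by (simp add: a_minus_def)
qed

lemma finsum_complex_line [simp]: "finite I \<Longrightarrow> (\<Oplus>\<^bsub>complex_line\<^esub>i\<in>I. f i) = (\<Sum>i\<in>I. f i)"
  by (induction I rule: finite_induct) (simp_all add: Pi_def)

theorem theorem3:
  shows
    "(\<forall>(V :: (complex, 'a) module) N (n :: nat) (\<alpha> :: nat \<Rightarrow> complex) (p :: nat \<Rightarrow> real) x
        (a :: complex) (A :: complex).
        complex_normed_space V N \<and> 1 \<le> n \<and>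
        (\<forall>i\<in>{1..n}. 0 \<le> p i) \<and> (\<Sum>i=1..n. p i) = 1 \<and>
        (\<forall>i\<in>{1..n}. x i \<in> carrier V)
        \<longrightarrow>
        ((\<forall>i\<in>{1..n}. 0 \<le> Re ((A - \<alpha> i) * (cnj (\<alpha> i) - cnj a))) \<longleftrightarrow>
         (\<forall>i\<in>{1..n}. cmod (\<alpha> i - (a + A) / 2) \<le> 1 / 2 * cmod (A - a))) \<and>
        ((\<forall>i\<in>{1..n}. 0 \<le> Re ((A - \<alpha> i) * (cnj (\<alpha> i) - cnj a))) \<longrightarrow>
         N ((\<Oplus>\<^bsub>V\<^esub>i\<in>{1..n}. (complex_of_real (p i) * \<alpha> i) \<odot>\<^bsub>V\<^esub> x i)
            \<ominus>\<^bsub>V\<^esub> (\<Sum>i=1..n. complex_of_real (p i) * \<alpha> i) \<odot>\<^bsub>V\<^esub>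
               (\<Oplus>\<^bsub>V\<^esub>i\<in>{1..n}. complex_of_real (p i) \<odot>\<^bsub>V\<^esub> x i))
         \<le> 1 / 2 * cmod (A - a) *
            (\<Sum>i=1..n. p i * N (x i \<ominus>\<^bsub>V\<^esub> (\<Oplus>\<^bsub>V\<^esub>j\<in>{1..n}. complex_of_real (p j) \<odot>\<^bsub>V\<^esub> x j)))))
     \<and>
     (\<forall>C :: real. 0 < C \<and>
        (\<forall>(V :: (complex, complex) module) N (n :: nat) (\<alpha> :: nat \<Rightarrow> complex) (p :: nat \<Rightarrow> real) x
           (a :: complex) (A :: complex).
           complex_normed_space V N \<and> 1 \<le> n \<and>
           (\<forall>i\<in>{1..n}. 0 \<le> p i) \<and> (\<Sum>i=1..n. p i) = 1 \<and>
           (\<forall>i\<in>{1..n}. x i \<in> carrier V) \<and>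
           (\<forall>i\<in>{1..n}. cmod (\<alpha> i - (a + A) / 2) \<le> 1 / 2 * cmod (A - a))
           \<longrightarrow>
           N ((\<Oplus>\<^bsub>V\<^esub>i\<in>{1..n}. (complex_of_real (p i) * \<alpha> i) \<odot>\<^bsub>V\<^esub> x i)
              \<ominus>\<^bsub>V\<^esub> (\<Sum>i=1..n. complex_of_real (p i) * \<alpha> i) \<odot>\<^bsub>V\<^esub>
                 (\<Oplus>\<^bsub>V\<^esub>i\<in>{1..n}. complex_of_real (p i) \<odot>\<^bsub>V\<^esub> x i))
           \<le> C * cmod (A - a) *
              (\<Sum>i=1..n. p i * N (x i \<ominus>\<^bsub>V\<^esub> (\<Oplus>\<^bsub>V\<^esub>j\<in>{1..n}. complex_of_real (p j) \<odot>\<^bsub>V\<^esub> x j))))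
        \<longrightarrow> 1 / 2 \<le> C)"
proof (intro conjI allI impI; (elim conjE)?)
  fix V :: "(complex, 'a) module" and N and n :: nat and \<alpha> :: "nat \<Rightarrow> complex"
    and p :: "nat \<Rightarrow> real" and x and a A :: complex
  show "(\<forall>i\<in>{1..n}. 0 \<le> Re ((A - \<alpha> i) * (cnj (\<alpha> i) - cnj a))) \<longleftrightarrow>
      (\<forall>i\<in>{1..n}. cmod (\<alpha> i - (a + A) / 2) \<le> 1 / 2 * cmod (A - a))"
    unfolding Re_mult_cnj_diff_nonneg_iff ..
  assume V: "complex_normed_space V N"
    and "\<forall>i\<in>{1..n}. 0 \<le> p i" "(\<Sum>i=1..n. p i) = 1" "\<forall>i\<in>{1..n}. x i \<in> carrier V"
    and "\<forall>i\<in>{1..n}. 0 \<le> Re ((A - \<alpha> i) * (cnj (\<alpha> i) - cnj a))"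
  then show "N ((\<Oplus>\<^bsub>V\<^esub>i\<in>{1..n}. (complex_of_real (p i) * \<alpha> i) \<odot>\<^bsub>V\<^esub> x i)
            \<ominus>\<^bsub>V\<^esub> (\<Sum>i=1..n. complex_of_real (p i) * \<alpha> i) \<odot>\<^bsub>V\<^esub>
               (\<Oplus>\<^bsub>V\<^esub>i\<in>{1..n}. complex_of_real (p i) \<odot>\<^bsub>V\<^esub> x i))
         \<le> 1 / 2 * cmod (A - a) *
            (\<Sum>i=1..n. p i * N (x i \<ominus>\<^bsub>V\<^esub> (\<Oplus>\<^bsub>V\<^esub>j\<in>{1..n}. complex_of_real (p j) \<odot>\<^bsub>V\<^esub> x j)))"
    \<comment> \<open>The hypothesis becomes the disc condition with centre
      \<open>(a + A) / 2\<close> and radius \<open>1 / 2 * cmod (A - a)\<close>.\<close>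
    unfolding Re_mult_cnj_diff_nonneg_iff
    by (intro complex_normed_space.norm_chebyshev_difference_le[OF V]) auto
next
  fix C :: real
  assume bound: "\<forall>(V :: (complex, complex) module) N (n :: nat) (\<alpha> :: nat \<Rightarrow> complex) (p :: nat \<Rightarrow> real) x
           (a :: complex) (A :: complex).
           complex_normed_space V N \<and> 1 \<le> n \<and>
           (\<forall>i\<in>{1..n}. 0 \<le> p i) \<and> (\<Sum>i=1..n. p i) = 1 \<and>
           (\<forall>i\<in>{1..n}. x i \<in> carrier V) \<and>
           (\<forall>i\<in>{1..n}. cmod (\<alpha> i - (a + A) / 2) \<le> 1 / 2 * cmod (A - a))
           \<longrightarrow>
           N ((\<Oplus>\<^bsub>V\<^esub>i\<in>{1..n}. (complex_of_real (p i) * \<alpha> i) \<odot>\<^bsub>V\<^esub> x i)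
              \<ominus>\<^bsub>V\<^esub> (\<Sum>i=1..n. complex_of_real (p i) * \<alpha> i) \<odot>\<^bsub>V\<^esub>
                 (\<Oplus>\<^bsub>V\<^esub>i\<in>{1..n}. complex_of_real (p i) \<odot>\<^bsub>V\<^esub> x i))
           \<le> C * cmod (A - a) *
              (\<Sum>i=1..n. p i * N (x i \<ominus>\<^bsub>V\<^esub> (\<Oplus>\<^bsub>V\<^esub>j\<in>{1..n}. complex_of_real (p j) \<odot>\<^bsub>V\<^esub> x j)))"
  \<comment> \<open>The sequence \<open>e\<close> serves as both \<open>\<alpha>\<close> and
    \<open>x\<close>, with \<open>a = 0\<close> and \<open>A = 1\<close>, so both values lie on the
    boundary of the disc. The left side is \<open>1/2 - 1/4 = 1/4\<close>; both deviations from the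
    mean have modulus \<open>1/2\<close>, so the right side is \<open>C / 2\<close>.\<close>
  define e :: "nat \<Rightarrow> complex" where "e i = (if i = 2 then 1 else 0)" for i
  \<comment> \<open>The lower bound is written \<open>Suc 0\<close> because the simplifier
    normalises the index set to that form.\<close>
  have two: "{Suc 0..2} = {1, 2}" by auto
  show "1 / 2 \<le> C"
    using bound[rule_format, of complex_line cmod 2 "\<lambda>_. 1 / 2" e e 0 1]
      complex_normed_space_complex_line
    by (simp add: two e_def norm_divide)
qed

end
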